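(* An element of $\widetilde{\mathbb{C}}(n)$ is invertible in the ring $\widetilde{\mathbb{C}}(n)$ if and only if it is strictly nonzero.
   Context: $n\in\mathbb{N}=\{1,2,\dots\}$. For expressions defined for small $\varepsilon>0$, $f(\varepsilon)=O(g(\varepsilon))$ means $\exists C>0\ \exists\varepsilon_0>0\ \forall\varepsilon<\varepsilon_0$: $|f(\varepsilon)|<C|g(\varepsilon)|$. $\mathcal{D}(\mathbb{R}^n)$ is the space of smooth compactly supported (complex-valued) functions. For $q\in\mathbb{N}_0$, $\mathcal{A}_q(\mathbb{R}^n)$ is the set of $\varphi\in\mathcal{D}(\mathbb{R}^n)$ with $\int\varphi=1$ and $\int x^\alpha\varphi(x)\,dx=0$ for all multi-indices $\alpha$ with $1\le|\alpha|\le q$. For $\varepsilon>0$, $(S_\varepsilon\varphi)(y):=\varepsilon^{-n}\varphi(y/\varepsilon)$. $\mathbb{C}_M(n)$ is the set of $r:\mathcal{A}_0(\mathbb{R}^n)\to\mathbb{C}$ such that $\exists N\in\mathbb{N}\ \forall\varphi\in\mathcal{A}_N(\mathbb{R}^n)$: $|r(S_\varepsilon\varphi)|=O(\varepsilon^{-N})$; $\mathbb{C}_N(n)$ is the set of $r:\mathcal{A}_0(\mathbb{R}^n)\to\mathbb{C}$ such that $\forall m\in\mathbb{N}\ \exists q\in\mathbb{N}\ \forall\varphi\in\mathcal{A}_q(\mathbb{R}^n)$: $|r(S_\varepsilon\varphi)|=O(\varepsilon^m)$; $\widetilde{\mathbb{C}}(n):=\mathbb{C}_M(n)/\mathbb{C}_N(n)$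 with pointwise operations. $\tilde r\in\widetilde{\mathbb{C}}(n)$ is called strictly nonzero if it has a representative $r\in\mathbb{C}_M(n)$ such that $\exists q\in\mathbb{N}\ \forall\varphi\in\mathcal{A}_q(\mathbb{R}^n)\ \exists C>0\ \exists\eta>0\ \forall\varepsilon<\eta$: $|r(S_\varepsilon\varphi)|>C\varepsilon^q$. *)

theory Defs
  imports
    "HOL-Analysis.Analysis"
    "HOL-Library.Landau_Symbols"
    "HOL-Library.FuncSet"
    "HOL-Algebra.QuotRing"
begin

text \<open>
  \<open>C_k k f\<close> says that \<open>f\<close> is of class \<open>C\<^sup>k\<close> on the whole space; \<open>axis i 1\<close> is the \<open>i\<close>-th standard
  basis vector, so the derivative in the recursive clause is the \<open>i\<close>-th partial derivative.
\<close>

primrec C_k :: "nat \<Rightarrow> (real ^ 'n \<Rightarrow> complex) \<Rightarrow> bool" where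
  "C_k 0 f \<longleftrightarrow> continuous_on UNIV f"
| "C_k (Suc k) f \<longleftrightarrow> f differentiable_on UNIV \<and>
     (\<forall>i. C_k k (\<lambda>x. frechet_derivative f (at x) (axis i 1)))"

definition test_functions :: "(real ^ 'n \<Rightarrow> complex) set" where
  "test_functions = {\<phi>. (\<forall>k. C_k k \<phi>) \<and> compact (closure {x. \<phi> x \<noteq> 0})}"

definition monomial_at :: "('n \<Rightarrow> nat) \<Rightarrow> real ^ 'n \<Rightarrow> real" where
  "monomial_at \<alpha> x = (\<Prod>i\<in>UNIV. (x $ i) ^ \<alpha> i)"

definition A_set :: "nat \<Rightarrow> (real ^ 'n \<Rightarrow> complex) set" where
  "A_set q = {\<phi> \<in> test_functions.
     (LINT x|lborel. \<phi> x) = 1 \<and>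
     (\<forall>\<alpha>. 1 \<le> sum \<alpha> UNIV \<and> sum \<alpha> UNIV \<le> q \<longrightarrow>
        (LINT x|lborel. monomial_at \<alpha> x *\<^sub>R \<phi> x) = 0)}"

definition S_scale :: "real \<Rightarrow> (real ^ 'n \<Rightarrow> complex) \<Rightarrow> real ^ 'n \<Rightarrow> complex" where
  "S_scale \<epsilon> \<phi> = (\<lambda>y. \<phi> (y /\<^sub>R \<epsilon>) /\<^sub>R \<epsilon> ^ CARD('n))"

text \<open>
  Functions with domain \<open>A_set 0\<close> are modelled as extensional functions, so that equality of
  functions is equality on \<open>A_set 0\<close>. The asymptotic parameter \<open>\<epsilon>\<close> tends to \<open>0\<close> through
  positive values. As the comparison functions are powers of \<open>\<epsilon>\<close>, which are positive, it does
  not matter that the Landau symbol of the library uses a non-strict inequality.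
\<close>

definition moderate :: "((real ^ 'n \<Rightarrow> complex) \<Rightarrow> complex) set" where
  "moderate = {r \<in> A_set 0 \<rightarrow>\<^sub>E UNIV. \<exists>N\<ge>1. \<forall>\<phi>\<in>A_set N.
     (\<lambda>\<epsilon>. cmod (r (S_scale \<epsilon> \<phi>))) \<in> O[at_right 0](\<lambda>\<epsilon>. \<epsilon> powi (- int N))}"

definition negligible :: "((real ^ 'n \<Rightarrow> complex) \<Rightarrow> complex) set" where
  "negligible = {r \<in> A_set 0 \<rightarrow>\<^sub>E UNIV. \<forall>m\<ge>1. \<exists>q\<ge>1. \<forall>\<phi>\<in>A_set q.
     (\<lambda>\<epsilon>. cmod (r (S_scale \<epsilon> \<phi>))) \<in> O[at_right 0](\<lambda>\<epsilon>. \<epsilon> ^ m)}"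

definition moderate_ring :: "((real ^ 'n \<Rightarrow> complex) \<Rightarrow> complex) ring" where
  "moderate_ring =
    \<lparr>carrier = moderate,
     mult = (\<lambda>r s. \<lambda>\<phi>\<in>A_set 0. r \<phi> * s \<phi>),
     one = (\<lambda>\<phi>\<in>A_set 0. 1),
     zero = (\<lambda>\<phi>\<in>A_set 0. 0),
     add = (\<lambda>r s. \<lambda>\<phi>\<in>A_set 0. r \<phi> + s \<phi>)\<rparr>"

definition generalized_numbers :: "((real ^ 'n \<Rightarrow> complex) \<Rightarrow> complex) set ring" where
  "generalized_numbers = moderate_ring Quot negligible"

definition strictly_nonzero :: "((real ^ 'n \<Rightarrow> complex) \<Rightarrow> complex) set \<Rightarrow> bool" where
  "strictly_nonzero R \<longleftrightarrow>
    (\<exists>r\<in>moderate. R = negligible +>\<^bsub>moderate_ring\<^esub> r \<and>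
      (\<exists>q\<ge>1. \<forall>\<phi>\<in>A_set q. \<exists>C>0. \<exists>\<eta>>0. \<forall>\<epsilon>. 0 < \<epsilon> \<and> \<epsilon> < \<eta> \<longrightarrow>
         cmod (r (S_scale \<epsilon> \<phi>)) > C * \<epsilon> ^ q))"

end

theory Submission
  imports Defs
begin

text \<open>
  Invertibility of the class of \<open>r\<close> means \<open>r s = 1 + n\<close> for some moderate \<open>s\<close> and negligible \<open>n\<close>.
  Along \<open>S_scale \<epsilon> \<phi>\<close>, with \<open>\<phi>\<close> having enough vanishing moments, \<open>n\<close> tends to \<open>0\<close> and \<open>\<bar>s\<bar>\<close> grows at
  most like \<open>\<epsilon> powi (- N)\<close>, so \<open>\<bar>r\<bar>\<close> cannot fall below a multiple of \<open>\<epsilon> ^ N\<close>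
  (\<open>bounded_below_if_invertible\<close>). Conversely, a lower bound \<open>C * \<epsilon> ^ q\<close> for \<open>\<bar>r\<bar>\<close> is an upper bound
  for the pointwise inverse of \<open>r\<close>, which is therefore moderate; where \<open>r\<close> vanishes its inverse may
  take any value, because this does not happen along \<open>S_scale \<epsilon> \<phi>\<close> for small \<open>\<epsilon>\<close>
  (\<open>invertible_if_bounded_below\<close>). The first argument applies to every representative of an
  invertible class, the second to any single one that is bounded below.

  To compute with pointwise products and inverses along \<open>S_scale \<epsilon> \<phi>\<close>, one has to know that rescaling
  does not lead out of \<open>A_set 0\<close>, since outside that set the ring operations return an unspecified
  value. This is the only analytic ingredient (\<open>S_scale_A_set\<close>); it rests on the chain rule and a
  linear substitution in the integral. The rest is algebra: moderate functions form a commutative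
  ring in which the negligible ones are an ideal, and units of the quotient lift to the equation
  \<open>r s = 1 + n\<close> (\<open>coset_in_Units_Quot_iff\<close>).
\<close>

section \<open>Rescaling of test functions\<close>

lemma A_set_antimono: "p \<le> q \<Longrightarrow> A_set q \<subseteq> A_set p"
  unfolding A_set_def by auto

text \<open>
  The outer factor \<open>c\<close> has to be arbitrary for the induction on \<open>k\<close>: each partial derivative turns it
  into \<open>c * a\<close>.
\<close>

lemma C_k_scaled:
  fixes f :: "real ^ 'n \<Rightarrow> complex"
  assumes "C_k k f"
  shows "C_k k (\<lambda>x. c *\<^sub>R f (a *\<^sub>R x))"
  using assms
proof (induction k arbitrary: f c)
  case 0
  then have "continuous_on UNIV f" by simp
  then have "continuous_on UNIV (\<lambda>x. f (a *\<^sub>R x))"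
    by (rule continuous_on_compose2) (auto intro!: continuous_intros)
  then show ?case by (auto intro!: continuous_intros)
next
  case (Suc k)
  have diff: "f differentiable (at y)" for y
    using Suc.prems by (simp add: differentiable_on_def)
  have deriv: "((\<lambda>x. c *\<^sub>R f (a *\<^sub>R x)) has_derivative
      (\<lambda>h. c *\<^sub>R frechet_derivative f (at (a *\<^sub>R x)) (a *\<^sub>R h))) (at x)" for x
  proof -
    have f: "(f has_derivative frechet_derivative f (at (a *\<^sub>R x))) (at (a *\<^sub>R x))"
      using diff frechet_derivative_works by blast
    have "((\<lambda>x. a *\<^sub>R x) has_derivative (\<lambda>h. a *\<^sub>R h)) (at x)"
      by (auto intro!: derivative_eq_intros)
    from has_derivative_compose[OF this f] show ?thesis
      by (rule has_derivative_scaleR_right)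
  qed
  have "frechet_derivative (\<lambda>x. c *\<^sub>R f (a *\<^sub>R x)) (at x) (axis i 1)
      = (c * a) *\<^sub>R frechet_derivative f (at (a *\<^sub>R x)) (axis i 1)" for x i
  proof -
    have "linear (frechet_derivative f (at (a *\<^sub>R x)))"
      using diff linear_frechet_derivative by blast
    then show ?thesis
      by (simp add: frechet_derivative_at[OF deriv, symmetric] linear_cmul)
  qed
  moreover have "(\<lambda>x. c *\<^sub>R f (a *\<^sub>R x)) differentiable_on UNIV"
    using deriv by (auto simp: differentiable_on_def differentiable_def)
  moreover have "C_k k (\<lambda>x. (c * a) *\<^sub>R frechet_derivative f (at (a *\<^sub>R x)) (axis i 1))" for i
    using Suc.IH[of "\<lambda>y. frechet_derivative f (at y) (axis i 1)"] Suc.prems by simp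
  ultimately show ?case
    by simp
qed

lemma S_scale_test_functions:
  fixes \<phi> :: "real ^ 'n \<Rightarrow> complex"
  assumes "\<phi> \<in> test_functions" and "\<epsilon> > 0"
  shows "S_scale \<epsilon> \<phi> \<in> test_functions"
proof -
  have "C_k k (S_scale \<epsilon> \<phi>)" for k
    using assms C_k_scaled[of k \<phi> "inverse (\<epsilon> ^ CARD('n))" "inverse \<epsilon>"]
    by (simp add: S_scale_def test_functions_def)
  moreover have "{x. S_scale \<epsilon> \<phi> x \<noteq> 0} \<subseteq> (\<lambda>x. \<epsilon> *\<^sub>R x) ` {x. \<phi> x \<noteq> 0}"
  proof
    fix x assume "x \<in> {x. S_scale \<epsilon> \<phi> x \<noteq> 0}"
    then have "\<phi> (x /\<^sub>R \<epsilon>) \<noteq> 0" by (simp add: S_scale_def)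
    moreover have "x = \<epsilon> *\<^sub>R (x /\<^sub>R \<epsilon>)" using \<open>\<epsilon> > 0\<close> by simp
    ultimately show "x \<in> (\<lambda>x. \<epsilon> *\<^sub>R x) ` {x. \<phi> x \<noteq> 0}" by blast
  qed
  then have "bounded {x. S_scale \<epsilon> \<phi> x \<noteq> 0}"
    using assms(1) by (auto simp: test_functions_def compact_closure
        intro: bounded_subset[OF bounded_scaling])
  ultimately show ?thesis
    by (simp add: test_functions_def compact_closure)
qed

text \<open>
  The substitution \<open>x = \<epsilon> y\<close>: the Jacobian \<open>\<epsilon> ^ CARD('n)\<close> is exactly what the normalising factor
  of \<^const>\<open>S_scale\<close> cancels.
\<close>

lemma integral_S_scale:
  fixes \<phi> :: "real ^ 'n \<Rightarrow> complex"
  assumes "continuous_on UNIV \<phi>" and "\<epsilon> > 0"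
  shows "(LINT x|lborel. S_scale \<epsilon> \<phi> x) = (LINT x|lborel. \<phi> x)"
proof -
  have meas [measurable]: "\<phi> \<in> borel_measurable borel"
    using assms(1) by (rule borel_measurable_continuous_onI)
  have [measurable]: "S_scale \<epsilon> \<phi> \<in> borel_measurable borel"
    unfolding S_scale_def by measurable
  have "(LINT x|lborel. S_scale \<epsilon> \<phi> x) =
      (LINT x|density (distr lborel borel (\<lambda>x. 0 + \<epsilon> *\<^sub>R x)) (\<lambda>_. \<bar>\<epsilon>\<bar> ^ DIM(real ^ 'n)). S_scale \<epsilon> \<phi> x)"
    using lborel_affine[of \<epsilon> "0 :: real ^ 'n"] assms(2) by simp
  also have "\<dots> = (LINT x|lborel. \<epsilon> ^ CARD('n) *\<^sub>R S_scale \<epsilon> \<phi> (\<epsilon> *\<^sub>R x))"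
    using assms(2) by (subst integral_density) (auto simp: integral_distr)
  also have "\<dots> = (LINT x|lborel. \<phi> x)"
    using assms(2) by (simp add: S_scale_def)
  finally show ?thesis .
qed

lemma S_scale_A_set:
  fixes \<phi> :: "real ^ 'n \<Rightarrow> complex"
  assumes "\<phi> \<in> A_set q" and "\<epsilon> > 0"
  shows "S_scale \<epsilon> \<phi> \<in> A_set 0"
proof -
  have \<phi>: "\<phi> \<in> test_functions" "(LINT x|lborel. \<phi> x) = 1"
    using assms(1) by (auto simp: A_set_def)
  then have "C_k 0 \<phi>"
    unfolding test_functions_def by blast
  then show ?thesis
    using \<phi> assms(2) by (auto simp: A_set_def S_scale_test_functions integral_S_scale)
qed

section \<open>Orders of growth along rescaled test functions\<close>

text \<open>
  Integer exponents let one notion serve both the growth rates \<open>- N\<close> of moderate and the decay rates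
  \<open>m\<close> of negligible functions, so that orders simply add up in products.
\<close>

definition order_along :: "(real ^ 'n \<Rightarrow> complex) \<Rightarrow> int \<Rightarrow> ((real ^ 'n \<Rightarrow> complex) \<Rightarrow> complex) \<Rightarrow> bool" where
  "order_along \<phi> k r \<longleftrightarrow>
     (\<lambda>\<epsilon>. cmod (r (S_scale \<epsilon> \<phi>))) \<in> O[at_right 0](\<lambda>\<epsilon>. \<epsilon> powi k)"

lemma moderate_iff:
  "r \<in> moderate \<longleftrightarrow> r \<in> A_set 0 \<rightarrow>\<^sub>E UNIV \<and> (\<exists>N\<ge>1. \<forall>\<phi>\<in>A_set N. order_along \<phi> (- int N) r)"
  by (simp add: moderate_def order_along_def)

lemma negligible_iff:
  "r \<in> negligible \<longleftrightarrow> r \<in> A_set 0 \<rightarrow>\<^sub>E UNIV \<and> (\<forall>m\<ge>1. \<exists>q\<ge>1. \<forall>\<phi>\<in>A_set q. order_along \<phi> (int m) r)"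
  by (simp add: negligible_def order_along_def)

lemma moderateI:
  assumes "r \<in> A_set 0 \<rightarrow>\<^sub>E UNIV" "N \<ge> 1"
    and "\<And>\<phi>. \<phi> \<in> A_set N \<Longrightarrow> order_along \<phi> (- int N) r"
  shows "r \<in> moderate"
  unfolding moderate_iff by (intro conjI exI[of _ N] ballI) (fact assms)+

lemma moderateE:
  assumes "r \<in> moderate"
  obtains N where "N \<ge> 1" "\<And>\<phi>. \<phi> \<in> A_set N \<Longrightarrow> order_along \<phi> (- int N) r"
  using assms that by (auto simp: moderate_iff)

lemma negligibleI:
  assumes "r \<in> A_set 0 \<rightarrow>\<^sub>E UNIV"
    and "\<And>m. m \<ge> 1 \<Longrightarrow> \<exists>q\<ge>1. \<forall>\<phi>\<in>A_set q. order_along \<phi> (int m) r"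
  shows "r \<in> negligible"
  unfolding negligible_iff by (intro conjI allI impI) (fact assms)+

lemma negligibleE:
  assumes "r \<in> negligible" "m \<ge> 1"
  obtains q where "q \<ge> 1" "\<And>\<phi>. \<phi> \<in> A_set q \<Longrightarrow> order_along \<phi> (int m) r"
proof -
  have "\<exists>q\<ge>1. \<forall>\<phi>\<in>A_set q. order_along \<phi> (int m) r"
    using assms(1) unfolding negligible_iff by (elim conjE allE impE) (rule assms(2))
  with that show ?thesis by auto
qed

lemma eventually_at_right_0_less:
  "(c :: real) > 0 \<Longrightarrow> eventually (\<lambda>\<epsilon>. 0 < \<epsilon> \<and> \<epsilon> < c) (at_right 0)"
  unfolding eventually_at_right_field by auto

lemma powi_bigo_powi_at_right_0:
  assumes "j \<le> k"
  shows "(\<lambda>\<epsilon>::real. \<epsilon> powi k) \<in> O[at_right 0](\<lambda>\<epsilon>. \<epsilon> powi j)"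
proof (rule bigoI[where c = 1])
  show "\<forall>\<^sub>F \<epsilon>::real in at_right 0. norm (\<epsilon> powi k) \<le> 1 * norm (\<epsilon> powi j)"
    by (rule eventually_mono[OF eventually_at_right_0_less[of 1]])
      (use assms in \<open>auto intro!: power_int_decreasing\<close>)
qed

lemma order_along_mono: "order_along \<phi> k r \<Longrightarrow> j \<le> k \<Longrightarrow> order_along \<phi> j r"
  unfolding order_along_def using powi_bigo_powi_at_right_0 landau_o.big_trans by blast

lemma order_along_const: "order_along \<phi> 0 (\<lambda>_. c)"
  unfolding order_along_def by simp

lemma order_along_zero [simp]: "order_along \<phi> k (\<lambda>_. 0)"
  unfolding order_along_def by simp

lemma order_along_add:
  assumes "order_along \<phi> k r" "order_along \<phi> k s"
  shows "order_along \<phi> k (\<lambda>\<psi>. r \<psi> + s \<psi>)"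
proof -
  let ?r = "\<lambda>\<epsilon>. cmod (r (S_scale \<epsilon> \<phi>))" and ?s = "\<lambda>\<epsilon>. cmod (s (S_scale \<epsilon> \<phi>))"
  have "(\<lambda>\<epsilon>. cmod (r (S_scale \<epsilon> \<phi>) + s (S_scale \<epsilon> \<phi>))) \<in> O[at_right 0](\<lambda>\<epsilon>. ?r \<epsilon> + ?s \<epsilon>)"
    by (rule bigoI[where c = 1]) (auto intro!: always_eventually norm_triangle_ineq)
  also have "(\<lambda>\<epsilon>. ?r \<epsilon> + ?s \<epsilon>) \<in> O[at_right 0](\<lambda>\<epsilon>. \<epsilon> powi k)"
    using assms unfolding order_along_def by (rule sum_in_bigo)
  finally show ?thesis
    unfolding order_along_def .
qed

lemma order_along_mult:
  assumes "order_along \<phi> j r" "order_along \<phi> k s"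
  shows "order_along \<phi> (j + k) (\<lambda>\<psi>. r \<psi> * s \<psi>)"
proof -
  have "(\<lambda>\<epsilon>. cmod (r (S_scale \<epsilon> \<phi>) * s (S_scale \<epsilon> \<phi>))) \<in> O[at_right 0](\<lambda>\<epsilon>. \<epsilon> powi j * \<epsilon> powi k)"
    using landau_o.big.mult[OF assms[unfolded order_along_def]] by (simp only: norm_mult)
  moreover have "\<forall>\<^sub>F \<epsilon>::real in at_right 0. \<epsilon> powi j * \<epsilon> powi k = \<epsilon> powi (j + k)"
    by (rule eventually_mono[OF eventually_at_right_0_less[of 1]]) (simp_all add: power_int_add)
  ultimately show ?thesis
    unfolding order_along_def by (simp cong: landau_o.big.cong)
qed

lemma order_along_cong:
  assumes "\<forall>\<^sub>F \<epsilon> in at_right 0. r (S_scale \<epsilon> \<phi>) = s (S_scale \<epsilon> \<phi>)"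
  shows "order_along \<phi> k r \<longleftrightarrow> order_along \<phi> k s"
  unfolding order_along_def
  by (rule landau_o.big.in_cong, rule eventually_mono[OF assms]) simp

text \<open>
  The estimates can thus be made for plain pointwise operations, although the ring operations are
  restricted to \<open>A_set 0\<close>.
\<close>

lemma order_along_restrict [simp]:
  assumes "\<phi> \<in> A_set q"
  shows "order_along \<phi> k (restrict r (A_set 0)) \<longleftrightarrow> order_along \<phi> k r"
  by (rule order_along_cong, rule eventually_mono[OF eventually_at_right_0_less[of 1]])
    (use assms in \<open>simp_all add: S_scale_A_set\<close>)

section \<open>Moderate functions form a ring and negligible ones an ideal\<close>

lemma negligible_subset_moderate: "(negligible :: ((real ^ 'n \<Rightarrow> complex) \<Rightarrow> complex) set) \<subseteq> moderate"
proof
  fix r :: "(real ^ 'n \<Rightarrow> complex) \<Rightarrow> complex"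
  assume r: "r \<in> negligible"
  then obtain q where q: "q \<ge> 1" "\<And>\<phi>. \<phi> \<in> A_set q \<Longrightarrow> order_along \<phi> (int 1) r"
    using order_refl by (rule negligibleE) blast
  have "order_along \<phi> (- int q) r" if "\<phi> \<in> A_set q" for \<phi>
    by (rule order_along_mono[OF q(2)[OF that]]) simp
  moreover have "r \<in> A_set 0 \<rightarrow>\<^sub>E UNIV"
    using r by (simp add: negligible_iff)
  ultimately show "r \<in> moderate"
    using q(1) by (intro moderateI)
qed

lemma moderate_const: "(\<lambda>\<phi>\<in>A_set 0. c) \<in> (moderate :: ((real ^ 'n \<Rightarrow> complex) \<Rightarrow> complex) set)"
proof -
  have "order_along \<phi> (- int 1) (\<lambda>\<phi>\<in>A_set 0. c)" if "\<phi> \<in> A_set 1" for \<phi> :: "real ^ 'n \<Rightarrow> complex"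
    using that order_along_mono[OF order_along_const[of \<phi> c], of "- 1"] by simp
  then show ?thesis
    by (intro moderateI[where N = 1]) simp_all
qed

lemma moderate_add:
  assumes "r \<in> moderate" "s \<in> moderate"
  shows "(\<lambda>\<phi>\<in>A_set 0. r \<phi> + s \<phi>) \<in> moderate"
proof -
  obtain M where M: "M \<ge> 1" "\<And>\<phi>. \<phi> \<in> A_set M \<Longrightarrow> order_along \<phi> (- int M) r"
    using assms(1) by (rule moderateE) blast
  obtain N where N: "N \<ge> 1" "\<And>\<phi>. \<phi> \<in> A_set N \<Longrightarrow> order_along \<phi> (- int N) s"
    using assms(2) by (rule moderateE) blast
  have "order_along \<phi> (- int (max M N)) (\<lambda>\<phi>\<in>A_set 0. r \<phi> + s \<phi>)" if \<phi>: "\<phi> \<in> A_set (max M N)" for \<phi>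
  proof -
    have "\<phi> \<in> A_set M" "\<phi> \<in> A_set N"
      using \<phi> A_set_antimono[of M "max M N"] A_set_antimono[of N "max M N"] by auto
    with M N have "order_along \<phi> (- int M) r" "order_along \<phi> (- int N) s" by auto
    then have "order_along \<phi> (- int (max M N)) r" "order_along \<phi> (- int (max M N)) s"
      by - (erule order_along_mono, simp)+
    then have "order_along \<phi> (- int (max M N)) (\<lambda>\<phi>. r \<phi> + s \<phi>)"
      by (rule order_along_add)
    then show ?thesis using \<phi> by simp
  qed
  with M(1) show ?thesis
    by (intro moderateI[where N = "max M N"]) simp_all
qed

lemma moderate_mult:
  assumes "r \<in> moderate" "s \<in> moderate"
  shows "(\<lambda>\<phi>\<in>A_set 0. r \<phi> * s \<phi>) \<in> moderate"
proof -
  obtain M where M: "M \<ge> 1" "\<And>\<phi>. \<phi> \<in> A_set M \<Longrightarrow> order_along \<phi> (- int M) r"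
    using assms(1) by (rule moderateE) blast
  obtain N where N: "N \<ge> 1" "\<And>\<phi>. \<phi> \<in> A_set N \<Longrightarrow> order_along \<phi> (- int N) s"
    using assms(2) by (rule moderateE) blast
  have "order_along \<phi> (- int (M + N)) (\<lambda>\<phi>\<in>A_set 0. r \<phi> * s \<phi>)" if \<phi>: "\<phi> \<in> A_set (M + N)" for \<phi>
  proof -
    have "\<phi> \<in> A_set M" "\<phi> \<in> A_set N"
      using \<phi> A_set_antimono[of M "M + N"] A_set_antimono[of N "M + N"] by auto
    with M N have "order_along \<phi> (- int M + - int N) (\<lambda>\<phi>. r \<phi> * s \<phi>)"
      by (intro order_along_mult) auto
    then show ?thesis using \<phi> by (simp add: algebra_simps)
  qed
  with M(1) show ?thesis
    by (intro moderateI[where N = "M + N"]) simp_all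
qed

lemma negligible_zero: "(\<lambda>\<phi>\<in>A_set 0. 0) \<in> negligible"
proof (rule negligibleI)
  show "\<exists>q\<ge>1. \<forall>\<phi>\<in>A_set q. order_along \<phi> (int m) (\<lambda>\<phi>\<in>A_set 0. 0)" for m
    by (rule exI[of _ 1]) simp
qed simp

lemma negligible_add:
  assumes "r \<in> negligible" "s \<in> negligible"
  shows "(\<lambda>\<phi>\<in>A_set 0. r \<phi> + s \<phi>) \<in> negligible"
proof (rule negligibleI)
  fix m :: nat assume m: "m \<ge> 1"
  obtain p where p: "p \<ge> 1" "\<And>\<phi>. \<phi> \<in> A_set p \<Longrightarrow> order_along \<phi> (int m) r"
    using assms(1) m by (rule negligibleE) blast
  obtain q where q: "q \<ge> 1" "\<And>\<phi>. \<phi> \<in> A_set q \<Longrightarrow> order_along \<phi> (int m) s"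
    using assms(2) m by (rule negligibleE) blast
  have "order_along \<phi> (int m) (\<lambda>\<phi>\<in>A_set 0. r \<phi> + s \<phi>)" if \<phi>: "\<phi> \<in> A_set (max p q)" for \<phi>
  proof -
    have "\<phi> \<in> A_set p" "\<phi> \<in> A_set q"
      using \<phi> A_set_antimono[of p "max p q"] A_set_antimono[of q "max p q"] by auto
    with p q \<phi> show ?thesis by (simp add: order_along_add)
  qed
  with p(1) show "\<exists>q\<ge>1. \<forall>\<phi>\<in>A_set q. order_along \<phi> (int m) (\<lambda>\<phi>\<in>A_set 0. r \<phi> + s \<phi>)"
    by (intro exI[of _ "max p q"]) auto
qed simp

text \<open>
  A moderate factor of order \<open>-N\<close> costs \<open>N\<close> powers of \<open>\<epsilon>\<close>, which negligibility of arbitrarily high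
  order makes up for.
\<close>

lemma negligible_mult:
  assumes "r \<in> moderate" "s \<in> negligible"
  shows "(\<lambda>\<phi>\<in>A_set 0. r \<phi> * s \<phi>) \<in> negligible"
proof -
  obtain N where N: "N \<ge> 1" "\<And>\<phi>. \<phi> \<in> A_set N \<Longrightarrow> order_along \<phi> (- int N) r"
    using assms(1) by (rule moderateE) blast
  show ?thesis
  proof (rule negligibleI)
    fix m :: nat assume "m \<ge> 1"
    then have "N + m \<ge> 1" by simp
    with assms(2) obtain q where q: "q \<ge> 1" "\<And>\<phi>. \<phi> \<in> A_set q \<Longrightarrow> order_along \<phi> (int (N + m)) s"
      by (rule negligibleE) blast
    have "order_along \<phi> (int m) (\<lambda>\<phi>\<in>A_set 0. r \<phi> * s \<phi>)" if \<phi>: "\<phi> \<in> A_set (max N q)" for \<phi>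
    proof -
      have "\<phi> \<in> A_set N" "\<phi> \<in> A_set q"
        using \<phi> A_set_antimono[of N "max N q"] A_set_antimono[of q "max N q"] by auto
      with N q have "order_along \<phi> (- int N + int (N + m)) (\<lambda>\<phi>. r \<phi> * s \<phi>)"
        by (intro order_along_mult) auto
      then show ?thesis using \<phi> by simp
    qed
    with N(1) show "\<exists>q\<ge>1. \<forall>\<phi>\<in>A_set q. order_along \<phi> (int m) (\<lambda>\<phi>\<in>A_set 0. r \<phi> * s \<phi>)"
      by (intro exI[of _ "max N q"]) auto
  qed simp
qed

lemma moderate_ring_simps:
  "carrier moderate_ring = moderate"
  "r \<otimes>\<^bsub>moderate_ring\<^esub> s = (\<lambda>\<phi>\<in>A_set 0. r \<phi> * s \<phi>)"
  "r \<oplus>\<^bsub>moderate_ring\<^esub> s = (\<lambda>\<phi>\<in>A_set 0. r \<phi> + s \<phi>)"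
  "\<one>\<^bsub>moderate_ring\<^esub> = (\<lambda>\<phi>\<in>A_set 0. 1)"
  "\<zero>\<^bsub>moderate_ring\<^esub> = (\<lambda>\<phi>\<in>A_set 0. 0)"
  by (simp_all add: moderate_ring_def)

lemma moderate_undefined: "r \<in> moderate \<Longrightarrow> \<phi> \<notin> A_set 0 \<Longrightarrow> r \<phi> = undefined"
  by (rule PiE_arb[where S = "A_set 0" and T = "\<lambda>_. UNIV"]) (simp_all add: moderate_iff)

lemma moderate_uminus:
  assumes "r \<in> moderate"
  shows "(\<lambda>\<phi>\<in>A_set 0. - r \<phi>) \<in> moderate"
proof -
  have "(\<lambda>\<phi>\<in>A_set 0. - r \<phi>) = (\<lambda>\<phi>\<in>A_set 0. (\<lambda>\<phi>\<in>A_set 0. - 1) \<phi> * r \<phi>)"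
    by (rule restrict_ext) simp
  then show ?thesis
    using moderate_mult[OF moderate_const assms] by simp
qed

lemma negligible_uminus:
  assumes "r \<in> negligible"
  shows "(\<lambda>\<phi>\<in>A_set 0. - r \<phi>) \<in> negligible"
proof -
  have "(\<lambda>\<phi>\<in>A_set 0. - r \<phi>) = (\<lambda>\<phi>\<in>A_set 0. (\<lambda>\<phi>\<in>A_set 0. - 1) \<phi> * r \<phi>)"
    by (rule restrict_ext) simp
  then show ?thesis
    using negligible_mult[OF moderate_const assms] by simp
qed

lemma cring_moderate_ring: "cring (moderate_ring :: ((real ^ 'n \<Rightarrow> complex) \<Rightarrow> complex) ring)"
proof (rule cringI)
  show "abelian_group (moderate_ring :: ((real ^ 'n \<Rightarrow> complex) \<Rightarrow> complex) ring)"
  proof (rule abelian_groupI, unfold moderate_ring_simps)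
    fix r :: "(real ^ 'n \<Rightarrow> complex) \<Rightarrow> complex" assume "r \<in> moderate"
    then show "\<exists>s\<in>moderate. (\<lambda>\<phi>\<in>A_set 0. s \<phi> + r \<phi>) = (\<lambda>\<phi>\<in>A_set 0. 0)"
      by (intro bexI[OF _ moderate_uminus]) (auto simp: restrict_def)
  qed (auto intro!: moderate_add moderate_const ext simp: moderate_undefined algebra_simps)
  show "comm_monoid (moderate_ring :: ((real ^ 'n \<Rightarrow> complex) \<Rightarrow> complex) ring)"
    by (rule comm_monoidI, unfold moderate_ring_simps)
      (auto intro!: moderate_mult moderate_const ext simp: moderate_undefined algebra_simps)
qed (auto intro!: ext simp: moderate_ring_simps algebra_simps)

lemma ideal_negligible: "ideal (negligible :: ((real ^ 'n \<Rightarrow> complex) \<Rightarrow> complex) set) moderate_ring"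
proof (rule idealI)
  interpret cring "moderate_ring :: ((real ^ 'n \<Rightarrow> complex) \<Rightarrow> complex) ring"
    by (rule cring_moderate_ring)
  show "ring (moderate_ring :: ((real ^ 'n \<Rightarrow> complex) \<Rightarrow> complex) ring)"
    by (rule ring_axioms)
  show "subgroup (negligible :: ((real ^ 'n \<Rightarrow> complex) \<Rightarrow> complex) set) (add_monoid moderate_ring)"
  proof (rule add.subgroupI)
    fix r :: "(real ^ 'n \<Rightarrow> complex) \<Rightarrow> complex" assume r: "r \<in> negligible"
    then have "r \<in> moderate" using negligible_subset_moderate by blast
    moreover have "(\<lambda>\<phi>\<in>A_set 0. - r \<phi>) \<oplus>\<^bsub>moderate_ring\<^esub> r = \<zero>\<^bsub>moderate_ring\<^esub>"
      by (auto simp: moderate_ring_simps restrict_def)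
    ultimately have "\<ominus>\<^bsub>moderate_ring\<^esub> r = (\<lambda>\<phi>\<in>A_set 0. - r \<phi>)"
      by (intro minus_equality) (auto simp: moderate_ring_simps moderate_uminus)
    then show "\<ominus>\<^bsub>moderate_ring\<^esub> r \<in> negligible"
      using negligible_uminus[OF r] by simp
  qed (use negligible_subset_moderate negligible_zero in
      \<open>auto simp: moderate_ring_simps negligible_add\<close>)
  fix r s :: "(real ^ 'n \<Rightarrow> complex) \<Rightarrow> complex"
  assume r: "r \<in> negligible" and s: "s \<in> carrier moderate_ring"
  then show "s \<otimes>\<^bsub>moderate_ring\<^esub> r \<in> negligible"
    by (simp add: moderate_ring_simps negligible_mult)
  then show "r \<otimes>\<^bsub>moderate_ring\<^esub> s \<in> negligible"
    by (simp add: moderate_ring_simps mult.commute)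
qed

section \<open>Invertibility of generalized numbers\<close>

text \<open>
  Every element of the quotient is a coset of some \<open>s\<close>, and the product of two cosets is the coset of
  the product; so an inverse exists iff some \<open>r s\<close> lies in the coset of \<open>1\<close>.
\<close>

lemma coset_in_Units_Quot_iff:
  assumes "cring A" "ideal I A" "r \<in> carrier A"
  shows "I +>\<^bsub>A\<^esub> r \<in> Units (A Quot I) \<longleftrightarrow>
    (\<exists>s\<in>carrier A. \<exists>n\<in>I. r \<otimes>\<^bsub>A\<^esub> s = n \<oplus>\<^bsub>A\<^esub> \<one>\<^bsub>A\<^esub>)"
proof -
  interpret A: cring A by fact
  interpret I: ideal I A by fact
  interpret Q: cring "A Quot I" using assms(1) by (rule I.quotient_is_cring)
  have coset_1: "I +>\<^bsub>A\<^esub> x = I +>\<^bsub>A\<^esub> \<one>\<^bsub>A\<^esub> \<longleftrightarrow> (\<exists>n\<in>I. x = n \<oplus>\<^bsub>A\<^esub> \<one>\<^bsub>A\<^esub>)"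
    if x: "x \<in> carrier A" for x
  proof -
    have "x \<in> I +>\<^bsub>A\<^esub> \<one>\<^bsub>A\<^esub> \<longleftrightarrow> (\<exists>n\<in>I. x = n \<oplus>\<^bsub>A\<^esub> \<one>\<^bsub>A\<^esub>)"
      by (auto simp: a_r_coset_def')
    then show ?thesis
      using x by (metis A.one_closed I.a_rcos_self I.a_repr_independence')
  qed
  have carrier: "carrier (A Quot I) = (\<lambda>s. I +>\<^bsub>A\<^esub> s) ` carrier A"
    by (auto simp: FactRing_def A_RCOSETS_def')
  have "I +>\<^bsub>A\<^esub> r \<in> Units (A Quot I) \<longleftrightarrow>
    (\<exists>s\<in>carrier A. (I +>\<^bsub>A\<^esub> r) \<otimes>\<^bsub>A Quot I\<^esub> (I +>\<^bsub>A\<^esub> s) = \<one>\<^bsub>A Quot I\<^esub>)"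
    using assms(3) Q.m_comm unfolding Units_def carrier by auto
  also have "\<dots> \<longleftrightarrow> (\<exists>s\<in>carrier A. I +>\<^bsub>A\<^esub> (r \<otimes>\<^bsub>A\<^esub> s) = I +>\<^bsub>A\<^esub> \<one>\<^bsub>A\<^esub>)"
    using assms(3) by (simp add: FactRing_def I.rcoset_mult_add)
  also have "\<dots> \<longleftrightarrow> (\<exists>s\<in>carrier A. \<exists>n\<in>I. r \<otimes>\<^bsub>A\<^esub> s = n \<oplus>\<^bsub>A\<^esub> \<one>\<^bsub>A\<^esub>)"
    using assms(3) coset_1 by auto
  finally show ?thesis .
qed

definition bounded_below :: "((real ^ 'n \<Rightarrow> complex) \<Rightarrow> complex) \<Rightarrow> bool" where
  "bounded_below r \<longleftrightarrow> (\<exists>q\<ge>1. \<forall>\<phi>\<in>A_set q. \<exists>C>0.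
     \<forall>\<^sub>F \<epsilon> in at_right 0. cmod (r (S_scale \<epsilon> \<phi>)) > C * \<epsilon> ^ q)"

lemma strictly_nonzero_iff:
  "strictly_nonzero R \<longleftrightarrow>
    (\<exists>r\<in>moderate. R = negligible +>\<^bsub>moderate_ring\<^esub> r \<and> bounded_below r)"
  unfolding strictly_nonzero_def bounded_below_def eventually_at_right_field
  by (simp only: imp_conjL)

text \<open>
  If \<open>r s = 1 + n\<close> with \<open>n\<close> negligible, then \<open>\<bar>r s\<bar> \<ge> 1 / 2\<close> for small \<open>\<epsilon>\<close>, while \<open>\<bar>s\<bar>\<close> is at most a
  multiple of \<open>\<epsilon> powi (- N)\<close>; so \<open>\<bar>r\<bar>\<close> is at least a multiple of \<open>\<epsilon> ^ N\<close>.
\<close>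

lemma bounded_below_if_invertible:
  assumes "s \<in> moderate" and "n \<in> negligible"
    and eq: "\<And>\<phi>. \<phi> \<in> A_set 0 \<Longrightarrow> r \<phi> * s \<phi> = n \<phi> + 1"
  shows "bounded_below r"
proof -
  obtain N where N: "N \<ge> 1" "\<And>\<phi>. \<phi> \<in> A_set N \<Longrightarrow> order_along \<phi> (- int N) s"
    using assms(1) by (rule moderateE) blast
  obtain p where p: "p \<ge> 1" "\<And>\<phi>. \<phi> \<in> A_set p \<Longrightarrow> order_along \<phi> (int 1) n"
    using assms(2) order_refl by (rule negligibleE) blast
  define q where "q = max N p"
  have "\<exists>C>0. \<forall>\<^sub>F \<epsilon> in at_right 0. cmod (r (S_scale \<epsilon> \<phi>)) > C * \<epsilon> ^ q"
    if \<phi>: "\<phi> \<in> A_set q" for \<phi>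
  proof -
    have "\<phi> \<in> A_set N" "\<phi> \<in> A_set p"
      using \<phi> A_set_antimono[of N q] A_set_antimono[of p q] by (auto simp: q_def)
    with N p have ord: "order_along \<phi> (- int N) s" "order_along \<phi> 1 n" by auto
    from ord(1) obtain B where B: "B > 0"
      "\<forall>\<^sub>F \<epsilon> in at_right 0. cmod (s (S_scale \<epsilon> \<phi>)) \<le> B * norm (\<epsilon> powi (- int N))"
      unfolding order_along_def by (auto elim: landau_o.bigE)
    from ord(2) obtain D where D: "D > 0"
      "\<forall>\<^sub>F \<epsilon> in at_right 0. cmod (n (S_scale \<epsilon> \<phi>)) \<le> D * norm (\<epsilon> powi 1)"
      unfolding order_along_def by (auto elim: landau_o.bigE)
    \<comment> \<open>below \<open>1 / (2 * D)\<close> the perturbation \<open>n\<close> is smaller than \<open>1 / 2\<close>\<close>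
    have "\<forall>\<^sub>F \<epsilon> in at_right 0. 0 < \<epsilon> \<and> \<epsilon> < min 1 (1 / (2 * D))"
      using D(1) by (intro eventually_at_right_0_less) simp
    with B(2) D(2)
    have "\<forall>\<^sub>F \<epsilon> in at_right 0. cmod (r (S_scale \<epsilon> \<phi>)) > 1 / (2 * B) * \<epsilon> ^ q"
    proof eventually_elim
      case (elim \<epsilon>)
      let ?r = "r (S_scale \<epsilon> \<phi>)" and ?s = "s (S_scale \<epsilon> \<phi>)" and ?n = "n (S_scale \<epsilon> \<phi>)"
      have \<epsilon>: "0 < \<epsilon>" "\<epsilon> < 1" "D * \<epsilon> < 1 / 2"
        using elim(3) D(1) by (auto simp: field_simps)
      have "?r * ?s = ?n + 1"
        using \<phi> \<epsilon>(1) by (intro eq S_scale_A_set)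
      moreover have "cmod ?n < 1 / 2"
        using elim(2) \<epsilon> by simp
      moreover have "1 \<le> cmod (?n + 1) + cmod ?n"
        using norm_triangle_ineq4[of "?n + 1" ?n] by simp
      ultimately have "1 / 2 < cmod ?r * cmod ?s"
        by (simp flip: norm_mult)
      also have "\<dots> \<le> cmod ?r * (B * inverse (\<epsilon> ^ N))"
        using elim(1) \<epsilon>(1) by (intro mult_left_mono) (auto simp: power_int_minus)
      finally have "1 / 2 * \<epsilon> ^ N < B * cmod ?r"
        using \<epsilon>(1) by (simp add: field_simps)
      moreover have "\<epsilon> ^ q \<le> \<epsilon> ^ N"
        using \<epsilon> by (intro power_decreasing) (auto simp: q_def)
      ultimately have "\<epsilon> ^ q < 2 * B * cmod ?r"
        by linarith
      then show ?case
        using B(1) by (simp add: field_simps)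
    qed
    then show ?thesis
      using B(1) by (intro exI[of _ "1 / (2 * B)"] conjI) simp_all
  qed
  moreover have "q \<ge> 1" using N by (simp add: q_def)
  ultimately show ?thesis
    unfolding bounded_below_def by blast
qed

text \<open>
  The pointwise inverse, which by the convention \<open>inverse 0 = 0\<close> is defined on all of
  \<open>A_set 0\<close>, inverts \<open>r\<close> up to a function that vanishes at \<open>S_scale \<epsilon> \<phi>\<close> for all small \<open>\<epsilon>\<close>.
\<close>

lemma invertible_if_bounded_below:
  fixes r :: "(real ^ 'n \<Rightarrow> complex) \<Rightarrow> complex"
  assumes "bounded_below r"
  shows "(\<lambda>\<phi>\<in>A_set 0. inverse (r \<phi>)) \<in> moderate"
    and "(\<lambda>\<phi>\<in>A_set 0. r \<phi> * inverse (r \<phi>) - 1) \<in> negligible"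
proof -
  obtain q where q: "q \<ge> 1" and
    lower: "\<And>\<phi>. \<phi> \<in> A_set q \<Longrightarrow> \<exists>C>0. \<forall>\<^sub>F \<epsilon> in at_right 0. cmod (r (S_scale \<epsilon> \<phi>)) > C * \<epsilon> ^ q"
    using assms unfolding bounded_below_def by blast
  have inv: "order_along \<phi> (- int q) (\<lambda>\<phi>. inverse (r \<phi>))" if \<phi>: "\<phi> \<in> A_set q" for \<phi>
  proof -
    obtain C where C: "C > 0" "\<forall>\<^sub>F \<epsilon> in at_right 0. cmod (r (S_scale \<epsilon> \<phi>)) > C * \<epsilon> ^ q"
      using lower[OF \<phi>] by blast
    have "\<forall>\<^sub>F \<epsilon> in at_right 0.
        norm (cmod (inverse (r (S_scale \<epsilon> \<phi>)))) \<le> inverse C * norm (\<epsilon> powi (- int q))"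
      using C(2) eventually_at_right_0_less[of 1, simplified]
    proof eventually_elim
      case (elim \<epsilon>)
      have "inverse (cmod (r (S_scale \<epsilon> \<phi>))) \<le> inverse (C * \<epsilon> ^ q)"
        using elim C(1) by (intro le_imp_inverse_le) auto
      then show ?case
        using elim by (simp add: norm_inverse power_int_minus)
    qed
    then show ?thesis
      unfolding order_along_def by (rule bigoI)
  qed
  with q show "(\<lambda>\<phi>\<in>A_set 0. inverse (r \<phi>)) \<in> moderate"
    by (intro moderateI[where N = q]) simp_all
  have "order_along \<phi> (int m) (\<lambda>\<phi>. r \<phi> * inverse (r \<phi>) - 1)" if \<phi>: "\<phi> \<in> A_set q" for \<phi> m
  proof -
    obtain C where C: "C > 0" "\<forall>\<^sub>F \<epsilon> in at_right 0. cmod (r (S_scale \<epsilon> \<phi>)) > C * \<epsilon> ^ q"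
      using lower[OF \<phi>] by blast
    have "\<forall>\<^sub>F \<epsilon> in at_right 0. r (S_scale \<epsilon> \<phi>) * inverse (r (S_scale \<epsilon> \<phi>)) - 1 = 0"
      using C(2) eventually_at_right_0_less[of 1, simplified]
    proof eventually_elim
      case (elim \<epsilon>)
      have "C * \<epsilon> ^ q > 0" using elim C(1) by simp
      with elim(1) have "cmod (r (S_scale \<epsilon> \<phi>)) > 0" by linarith
      then show ?case by simp
    qed
    then have "order_along \<phi> (int m) (\<lambda>\<phi>. r \<phi> * inverse (r \<phi>) - 1) \<longleftrightarrow> order_along \<phi> (int m) (\<lambda>_. 0)"
      by (rule order_along_cong)
    then show ?thesis by simp
  qed
  with q have "\<exists>q\<ge>1. \<forall>\<phi>\<in>A_set q. order_along \<phi> (int m) (\<lambda>\<phi>\<in>A_set 0. r \<phi> * inverse (r \<phi>) - 1)" for m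
    by (intro exI[of _ q]) simp
  then show "(\<lambda>\<phi>\<in>A_set 0. r \<phi> * inverse (r \<phi>) - 1) \<in> negligible"
    by (intro negligibleI) simp_all
qed

lemma coset_in_Units_iff_bounded_below:
  fixes r :: "(real ^ 'n \<Rightarrow> complex) \<Rightarrow> complex"
  assumes "r \<in> moderate"
  shows "negligible +>\<^bsub>moderate_ring\<^esub> r \<in> Units generalized_numbers \<longleftrightarrow> bounded_below r"
proof -
  have one: "(\<lambda>\<phi>\<in>A_set 0. n \<phi> + (\<lambda>\<phi>\<in>A_set 0. 1) \<phi>) = (\<lambda>\<phi>\<in>A_set 0. n \<phi> + 1)"
    for n :: "(real ^ 'n \<Rightarrow> complex) \<Rightarrow> complex"
    by (rule restrict_ext) simp
  have "negligible +>\<^bsub>moderate_ring\<^esub> r \<in> Units generalized_numbers \<longleftrightarrow>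
    (\<exists>s\<in>moderate. \<exists>n\<in>negligible. (\<lambda>\<phi>\<in>A_set 0. r \<phi> * s \<phi>) = (\<lambda>\<phi>\<in>A_set 0. n \<phi> + 1))"
    using coset_in_Units_Quot_iff[OF cring_moderate_ring ideal_negligible, of r] assms
    unfolding generalized_numbers_def moderate_ring_simps one by blast
  also have "\<dots> \<longleftrightarrow> bounded_below r"
  proof
    assume "\<exists>s\<in>moderate. \<exists>n\<in>negligible. (\<lambda>\<phi>\<in>A_set 0. r \<phi> * s \<phi>) = (\<lambda>\<phi>\<in>A_set 0. n \<phi> + 1)"
    then obtain s n where sn: "s \<in> moderate" "n \<in> negligible"
      and eq: "(\<lambda>\<phi>\<in>A_set 0. r \<phi> * s \<phi>) = (\<lambda>\<phi>\<in>A_set 0. n \<phi> + 1)"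
      by (elim bexE)
    show "bounded_below r"
      using sn
    proof (rule bounded_below_if_invertible)
      show "r \<phi> * s \<phi> = n \<phi> + 1" if "\<phi> \<in> A_set 0" for \<phi>
        using fun_cong[OF eq, of \<phi>] that by simp
    qed
  next
    let ?s = "\<lambda>\<phi>\<in>A_set 0. inverse (r \<phi>)" and ?n = "\<lambda>\<phi>\<in>A_set 0. r \<phi> * inverse (r \<phi>) - 1"
    assume "bounded_below r"
    note sn = invertible_if_bounded_below[OF this]
    have "(\<lambda>\<phi>\<in>A_set 0. r \<phi> * ?s \<phi>) = (\<lambda>\<phi>\<in>A_set 0. ?n \<phi> + 1)"
      by (rule restrict_ext) simp
    with sn show "\<exists>s\<in>moderate. \<exists>n\<in>negligible. (\<lambda>\<phi>\<in>A_set 0. r \<phi> * s \<phi>) = (\<lambda>\<phi>\<in>A_set 0. n \<phi> + 1)"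
      by (intro bexI)
  qed
  finally show ?thesis .
qed

theorem proposition18:
  fixes R :: "((real ^ 'n \<Rightarrow> complex) \<Rightarrow> complex) set"
  assumes "R \<in> carrier generalized_numbers"
  shows "R \<in> Units generalized_numbers \<longleftrightarrow> strictly_nonzero R"
proof -
  obtain r where "r \<in> moderate" "R = negligible +>\<^bsub>moderate_ring\<^esub> r"
    using assms
    by (auto simp: generalized_numbers_def FactRing_def A_RCOSETS_def' moderate_ring_simps)
  then show ?thesis
    using coset_in_Units_iff_bounded_below unfolding strictly_nonzero_iff by blast
qed

end
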